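(* Let $\mathfrak X$ be a Hausdorff topological space and let $\Sigma$ be a countable subsemigroup of the semigroup (under composition) of continuous self-maps of $\mathfrak X$. Suppose that $\Sigma$ admits a F\o lner sequence $(\Sigma_k)_{k\ge1}$. If there is a point $x_0\in\mathfrak X$ and a compact subset $K_0\subset\mathfrak X$ such that $$\limsup_{k\to+\infty}\left(\sup_{s\in\Sigma}\frac1{|\Sigma_k|}\sum_{h\in\Sigma_k}\mathbf 1_{K_0}(h\circ s(x_0))\right)>0,$$ then there exists a $\Sigma$-invariant Radon probability measure $\mu\colon\mathcal B_{\mathfrak X}\to[0,1]$ such that $\mu(K_0)>0$.
   Context: A F\o lner sequence of a countable semigroup $\Sigma$ is a sequence $(\Sigma_k)_{k\ge1}$ of non-empty finite subsets of $\Sigma$ such that $\lim_{k\to+\infty}\frac{|s\Sigma_k\,\triangle\,\Sigma_k|}{|\Sigma_k|}=0$ for all $s\in\Sigma$. $\mathcal B_{\mathfrak X}$ denotes the Borel $\sigma$-algebra of $\mathfrak X$. A Borel measure $\mu\colon\mathcal B_{\mathfrak X}\to[0,+\infty]$ is a Radon measure if $\mu(K)<+\infty$ for all compact $K$ and $\mu(B)=\sup\{\mu(K):K\subset B,\ K\text{ compact}\}$ for all Borel sets $B$. A measure $\mu$ is $\Sigma$-invariant if $s_\ast\mu=\mu$ for all $s\in\Sigma$, where $s_\ast\mu(B)=\mu(s^{-1}(B))$. $\mathbf 1_{K_0}$ is the indicator function of $K_0$. *)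

theory Defs
  imports "HOL-Probability.Probability"
begin

definition continuous_map_semigroup :: "('a::topological_space \<Rightarrow> 'a) set \<Rightarrow> bool" where
  "continuous_map_semigroup S \<longleftrightarrow>
     (\<forall>f\<in>S. continuous_on UNIV f) \<and> (\<forall>f\<in>S. \<forall>g\<in>S. f \<circ> g \<in> S)"

(* The semigroup is the set S with the operation opr. The sequence is indexed by k \<ge> 1,
   so F 0 is unconstrained. *)
definition folner_sequence :: "('s \<Rightarrow> 's \<Rightarrow> 's) \<Rightarrow> 's set \<Rightarrow> (nat \<Rightarrow> 's set) \<Rightarrow> bool" where
  "folner_sequence opr S F \<longleftrightarrow>
     (\<forall>k\<ge>1. F k \<noteq> {} \<and> finite (F k) \<and> F k \<subseteq> S) \<and>
     (\<forall>s\<in>S. (\<lambda>k. real (card (sym_diff (opr s ` F k) (F k))) / real (card (F k)))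
               \<longlonglongrightarrow> 0)"

(* Stated for Hausdorff spaces, where compact sets are Borel; elsewhere emeasure would
   assign the default value 0 to a non-Borel compact set. *)
definition radon_measure :: "'a::t2_space measure \<Rightarrow> bool" where
  "radon_measure M \<longleftrightarrow>
     sets M = sets borel \<and>
     (\<forall>K. compact K \<longrightarrow> emeasure M K < \<infinity>) \<and>
     (\<forall>B\<in>sets borel. emeasure M B = (SUP K\<in>{K. K \<subseteq> B \<and> compact K}. emeasure M K))"

(* Intended for maps that are measurable from M to M, such as continuous maps when M is Borel;
   only then is distr M M s the push-forward B \<mapsto> M (s -` B). *)
definition invariant_measure :: "('a \<Rightarrow> 'a) set \<Rightarrow> 'a measure \<Rightarrow> bool" where
  "invariant_measure S M \<longleftrightarrow> (\<forall>s\<in>S. distr M M s = M)"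

end

theory Submission
  imports Defs
begin

text \<open>
  Record how often the orbit pieces \<open>h (s x0)\<close>, \<open>h \<in> F k\<close>, visit a set. For infinitely many \<open>k\<close>
  and an \<open>s\<close> chosen for each of them, the frequency of visits to \<open>K0\<close> exceeds a fixed \<open>c > 0\<close>. The space
  is not assumed locally compact, so the frequencies, read as measures, may lose mass and need not
  have weak limits; but as functions on all subsets with values in \<open>[0, 1]\<close> they live in a compact
  product, and converge pointwise along some filter to a finitely additive \<open>m\<close> with \<open>m K0 \<ge> c\<close>
  (\<open>folner_limit_charge\<close>). The Folner property makes \<open>m\<close> subinvariant: \<open>m (s -` A) \<le> m A\<close>.

  Only the values of \<open>m\<close> on compact sets are kept. They form a content, and in any Hausdorff space
  a bounded content gives rise, through inner approximation of open sets and outer approximation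
  of all sets, to a finite Radon measure \<open>\<mu>\<close> (\<open>radon_measure_radon_extension\<close>). It satisfies
  \<open>m K \<le> \<mu> K\<close> for compact \<open>K\<close>, which is the right direction for \<open>\<mu> K0 > 0\<close>.

  Invariance comes from compact sets having compact images: \<open>m K \<le> m (s -` (s ` K)) \<le> m (s ` K)\<close>
  gives \<open>\<mu> (s -` G) \<le> \<mu> G\<close> for open \<open>G\<close>, hence for Borel sets. Both sides are finite measures
  with the same total mass, so the inequality for a set and for its complement forces equality
  (\<open>distr_radon_extension\<close>). It remains to normalise.
\<close>

section \<open>Radon measures from contents on compact sets\<close>

text \<open>
  This replaces partitions of unity, which would need local compactness: the compact sets
  \<open>K - G\<close> and \<open>K - H\<close> are disjoint and have disjoint open neighbourhoods, whose complements
  in \<open>K\<close> are the two pieces.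
\<close>

lemma compact_split_open_cover:
  fixes K :: "'a::t2_space set"
  assumes "compact K" "open G" "open H" "K \<subseteq> G \<union> H"
  obtains K1 K2 where "compact K1" "compact K2" "K1 \<subseteq> G" "K2 \<subseteq> H" "K = K1 \<union> K2"
proof -
  have "compact (K - G)" "compact (K - H)"
    using assms by (auto intro: compact_diff)
  moreover have "disjnt (K - G) (K - H)"
    using assms(4) by (auto simp: disjnt_def)
  moreover have "Hausdorff_space (euclidean :: 'a topology)"
    unfolding Hausdorff_space_def disjnt_def by (simp, metis hausdorff)
  ultimately obtain U V where UV: "open U" "open V" "K - G \<subseteq> U" "K - H \<subseteq> V" "disjnt U V"
    using Hausdorff_space_compact_separation[of euclidean "K - G" "K - H"] by auto
  show thesis
  proof (rule that)
    show "compact (K - U)" "compact (K - V)"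
      using assms(1) UV(1,2) by (auto intro: compact_diff)
    show "K - U \<subseteq> G" "K - V \<subseteq> H" "K = (K - U) \<union> (K - V)"
      using UV(3-5) by (auto simp: disjnt_def)
  qed
qed

text \<open>
  A content need not be the restriction of a measure: a limit of unit point masses at points that
  approach a compact set from outside vanishes on that set. The extension below may therefore
  increase the values on compact sets.
\<close>

locale compact_content =
  fixes m :: "'a::t2_space set \<Rightarrow> ennreal"
  assumes mono: "compact K \<Longrightarrow> compact L \<Longrightarrow> K \<subseteq> L \<Longrightarrow> m K \<le> m L"
    and subadditive: "compact K \<Longrightarrow> compact L \<Longrightarrow> m (K \<union> L) \<le> m K + m L"
    and additive: "compact K \<Longrightarrow> compact L \<Longrightarrow> K \<inter> L = {} \<Longrightarrow> m (K \<union> L) = m K + m L"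
    and bounded: "(SUP K\<in>{K. compact K}. m K) < \<infinity>"
begin

definition inner :: "'a set \<Rightarrow> ennreal" where
  "inner G = (SUP K\<in>{K. K \<subseteq> G \<and> compact K}. m K)"

definition outer :: "'a set \<Rightarrow> ennreal" where
  "outer A = (INF G\<in>{G. open G \<and> A \<subseteq> G}. inner G)"

definition radon_extension :: "'a measure" where
  "radon_extension = measure_of UNIV (sets borel) outer"

lemma le_inner: "compact K \<Longrightarrow> K \<subseteq> G \<Longrightarrow> m K \<le> inner G"
  unfolding inner_def by (auto intro: SUP_upper)

lemma inner_mono: "G \<subseteq> H \<Longrightarrow> inner G \<le> inner H"
  unfolding inner_def by (intro SUP_subset_mono) auto

lemma inner_finite: "inner G < \<infinity>"
proof -
  have "inner G \<le> (SUP K\<in>{K. compact K}. m K)"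
    unfolding inner_def by (intro SUP_subset_mono) auto
  then show ?thesis using bounded by simp
qed

lemma content_empty: "m {} = 0"
proof -
  have "m {} < \<infinity>"
    using le_inner[of "{}" "{}"] inner_finite[of "{}"] by (auto intro: le_less_trans)
  moreover have "m {} + m {} = m {} + 0"
    using additive[of "{}" "{}"] by simp
  ultimately show ?thesis
    using ennreal_add_left_cancel[of "m {}" "m {}" 0] by auto
qed

lemma inner_empty: "inner {} = 0"
  by (simp add: inner_def content_empty)

lemma inner_Un_le:
  assumes "open G" "open H"
  shows "inner (G \<union> H) \<le> inner G + inner H"
  unfolding inner_def[of "G \<union> H"]
proof (rule SUP_least)
  fix K assume "K \<in> {K. K \<subseteq> G \<union> H \<and> compact K}"
  then obtain K1 K2 where K: "compact K1" "compact K2" "K1 \<subseteq> G" "K2 \<subseteq> H" "K = K1 \<union> K2"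
    using compact_split_open_cover[of K G H] assms by auto
  have "m K \<le> m K1 + m K2" using subadditive K by simp
  also have "\<dots> \<le> inner G + inner H" using K by (intro add_mono le_inner)
  finally show "m K \<le> inner G + inner H" .
qed

lemma inner_UN_lessThan_le:
  fixes G :: "nat \<Rightarrow> 'a set"
  assumes "\<And>i. open (G i)"
  shows "inner (\<Union>i<n. G i) \<le> (\<Sum>i<n. inner (G i))"
proof (induction n)
  case 0
  then show ?case by (simp add: inner_empty)
next
  case (Suc n)
  have "inner (\<Union>i<Suc n. G i) = inner ((\<Union>i<n. G i) \<union> G n)"
    by (simp add: lessThan_Suc Un_commute)
  also have "\<dots> \<le> inner (\<Union>i<n. G i) + inner (G n)"
    using assms by (intro inner_Un_le) auto
  also have "\<dots> \<le> (\<Sum>i<Suc n. inner (G i))"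
    using Suc.IH by (simp add: add_right_mono)
  finally show ?case .
qed

text \<open>
  Finite subadditivity is enough here, because a compact subset of the union lies in finitely many
  of the sets; this is where countable additivity of the extension comes from.
\<close>

lemma inner_UN_le:
  fixes G :: "nat \<Rightarrow> 'a set"
  assumes "\<And>i. open (G i)"
  shows "inner (\<Union>i. G i) \<le> (\<Sum>i. inner (G i))"
  unfolding inner_def[of "\<Union>i. G i"]
proof (rule SUP_least)
  fix K assume "K \<in> {K. K \<subseteq> (\<Union>i. G i) \<and> compact K}"
  then have K: "compact K" "K \<subseteq> (\<Union>i. G i)" by auto
  obtain I where I: "finite I" "K \<subseteq> (\<Union>i\<in>I. G i)"
    using compactE_image[OF K(1), of UNIV G] assms K(2) by auto
  obtain n where "I \<subseteq> {..<n}"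
    using I(1) finite_nat_iff_bounded by blast
  then have "K \<subseteq> (\<Union>i<n. G i)" using I(2) by blast
  then have "m K \<le> inner (\<Union>i<n. G i)" using K by (intro le_inner)
  also have "\<dots> \<le> (\<Sum>i<n. inner (G i))" using assms by (rule inner_UN_lessThan_le)
  also have "\<dots> \<le> (\<Sum>i. inner (G i))" by (intro sum_le_suminf) auto
  finally show "m K \<le> (\<Sum>i. inner (G i))" .
qed

lemma outer_le_inner: "open G \<Longrightarrow> A \<subseteq> G \<Longrightarrow> outer A \<le> inner G"
  unfolding outer_def by (auto intro: INF_lower)

lemma outer_open: "open G \<Longrightarrow> outer G = inner G"
  by (intro antisym outer_le_inner) (auto simp: outer_def intro!: INF_greatest inner_mono)

lemma outer_mono: "A \<subseteq> B \<Longrightarrow> outer A \<le> outer B"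
  unfolding outer_def by (intro INF_superset_mono) auto

lemma content_le_outer: "compact K \<Longrightarrow> m K \<le> outer K"
  unfolding outer_def by (auto intro!: INF_greatest le_inner)

lemma outer_finite: "outer A < \<infinity>"
  using outer_le_inner[of UNIV A] inner_finite[of UNIV] by (auto intro: le_less_trans)

lemma outer_approx:
  assumes "e > 0"
  obtains G where "open G" "A \<subseteq> G" "inner G \<le> outer A + ennreal e"
proof -
  have "outer A < outer A + ennreal e"
    using outer_finite[of A] assms ennreal_add_left_cancel_less[of "outer A" 0 "ennreal e"] by simp
  then have "(INF G\<in>{G. open G \<and> A \<subseteq> G}. inner G) < outer A + ennreal e"
    by (simp only: outer_def[of A, symmetric])
  then obtain G where "open G" "A \<subseteq> G" "inner G < outer A + ennreal e"
    by (auto dest: INF_less_iff[THEN iffD1])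
  then show thesis using that by (auto intro: less_imp_le)
qed

lemma inner_approx:
  assumes "e > 0"
  obtains K where "compact K" "K \<subseteq> G" "inner G \<le> m K + ennreal e"
proof (cases "inner G = 0")
  case True
  then show thesis using that[of "{}"] by simp
next
  case False
  then have "inner G - ennreal e < inner G"
    using inner_finite[of G] assms by (intro ennreal_between) (auto simp: zero_less_iff_neq_zero)
  then have "inner G - ennreal e < (SUP K\<in>{K. K \<subseteq> G \<and> compact K}. m K)"
    by (simp only: inner_def[of G, symmetric])
  then obtain K where K: "K \<subseteq> G" "compact K" "inner G - ennreal e < m K"
    by (auto dest: less_SUP_iff[THEN iffD1])
  have "inner G \<le> ennreal e + m K"
    using K(3)[THEN less_imp_le] by (simp only: ennreal_minus_le_iff)
  then show thesis
    using that[of K] K by (simp only: add.commute)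
qed

lemma countably_subadditive_outer: "countably_subadditive UNIV outer"
  unfolding countably_subadditive_def
proof safe
  fix A :: "nat \<Rightarrow> 'a set"
  show "outer (\<Union>i. A i) \<le> (\<Sum>i. outer (A i))"
  proof (rule ennreal_le_epsilon)
    fix e :: real assume "e > 0"
    have "\<exists>G. open G \<and> A i \<subseteq> G \<and> inner G \<le> outer (A i) + ennreal (e * (1/2)^Suc i)" for i
      by (rule outer_approx[of "e * (1/2)^Suc i" "A i"]) (use \<open>e > 0\<close> in auto)
    then obtain G where G: "\<And>i. open (G i)" "\<And>i. A i \<subseteq> G i"
      "\<And>i. inner (G i) \<le> outer (A i) + ennreal (e * (1/2)^Suc i)"
      by metis
    have "outer (\<Union>i. A i) \<le> inner (\<Union>i. G i)"
      using G by (intro outer_le_inner) auto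
    also have "\<dots> \<le> (\<Sum>i. inner (G i))" using G(1) by (rule inner_UN_le)
    also have "\<dots> \<le> (\<Sum>i. outer (A i) + ennreal (e * (1/2)^Suc i))"
      using G(3) by (intro suminf_le) auto
    also have "\<dots> = (\<Sum>i. outer (A i)) + (\<Sum>i. ennreal (e * (1/2)^Suc i))"
      by (intro suminf_add[symmetric]) auto
    also have "(\<Sum>i. ennreal (e * (1/2)^Suc i)) = ennreal e"
      using \<open>e > 0\<close> sums_mult[OF power_half_series, of e]
      by (intro suminf_ennreal_eq) auto
    finally show "outer (\<Union>i. A i) \<le> (\<Sum>i. outer (A i)) + ennreal e" .
  qed
qed

lemma outer_measure_space_outer: "outer_measure_space UNIV outer"
  using countably_subadditive_outer outer_mono
  by (auto simp: outer_measure_space_def positive_def increasing_def outer_open inner_empty)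

lemma outer_Un_le: "outer (A \<union> B) \<le> outer A + outer B"
proof -
  interpret sigma_algebra UNIV "UNIV :: 'a set set"
    using sigma_algebra_Pow[of "UNIV :: 'a set"] by simp
  show ?thesis
    using countably_subadditive_subadditive[of outer] outer_measure_space_outer
    by (auto simp: outer_measure_space_def subadditive_def)
       (metis UNIV_I Un_Diff_cancel Diff_disjoint Diff_subset add_left_mono order_trans outer_mono)
qed

text \<open>
  The Caratheodory condition for \<open>G\<close>, tested on open sets. Exhausting \<open>H \<inter> G\<close> by a compact \<open>K\<close>
  first leaves an open set \<open>H - K\<close>, in which a compact \<open>L\<close> can be chosen; \<open>K\<close> and \<open>L\<close> are disjoint
  and additivity of the content applies.
\<close>

lemma inner_split_open:
  assumes "open G" "open H"
  shows "outer (H \<inter> G) + outer (H - G) \<le> inner H"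
proof (rule ennreal_le_epsilon)
  fix e :: real assume "e > 0"
  then have e2: "e/2 > 0" by simp
  obtain K where K: "compact K" "K \<subseteq> H \<inter> G" "inner (H \<inter> G) \<le> m K + ennreal (e/2)"
    using inner_approx[OF e2] by blast
  obtain L where L: "compact L" "L \<subseteq> H - K" "inner (H - K) \<le> m L + ennreal (e/2)"
    using inner_approx[OF e2] by blast
  have "open (H - K)" using assms(2) K(1) by (simp add: compact_imp_closed open_Diff)
  then have "outer (H - G) \<le> inner (H - K)" using K(2) by (intro outer_le_inner) auto
  moreover have "outer (H \<inter> G) = inner (H \<inter> G)"
    using assms by (intro outer_open open_Int)
  ultimately have "outer (H \<inter> G) + outer (H - G) \<le> (m K + ennreal (e/2)) + (m L + ennreal (e/2))"
    using K(3) L(3) by (intro add_mono) (auto intro: order_trans)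
  also have "\<dots> = (m K + m L) + (ennreal (e/2) + ennreal (e/2))"
    by (simp only: ac_simps)
  also have "ennreal (e/2) + ennreal (e/2) = ennreal e"
    using \<open>e > 0\<close> by (simp add: ennreal_plus[symmetric] del: ennreal_plus)
  also have "m K + m L = m (K \<union> L)"
    using L(2) by (intro additive[OF K(1) L(1), symmetric]) auto
  also have "m (K \<union> L) + ennreal e \<le> inner H + ennreal e"
    using K L by (intro add_right_mono le_inner) auto
  finally show "outer (H \<inter> G) + outer (H - G) \<le> inner H + ennreal e" .
qed

lemma open_in_lambda_system:
  assumes "open G"
  shows "G \<in> lambda_system UNIV UNIV outer"
proof -
  interpret sigma_algebra UNIV "UNIV :: 'a set set"
    using sigma_algebra_Pow[of "UNIV :: 'a set"] by simp
  have "outer (A \<inter> G) + outer (A - G) = outer A" for A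
  proof (rule antisym)
    show "outer (A \<inter> G) + outer (A - G) \<le> outer A"
      unfolding outer_def[of A]
    proof (rule INF_greatest)
      fix H assume "H \<in> {H. open H \<and> A \<subseteq> H}"
      then have H: "open H" "A \<subseteq> H" by auto
      have "outer (A \<inter> G) + outer (A - G) \<le> outer (H \<inter> G) + outer (H - G)"
        using H(2) by (intro add_mono outer_mono) auto
      also have "\<dots> \<le> inner H" using assms H(1) by (rule inner_split_open)
      finally show "outer (A \<inter> G) + outer (A - G) \<le> inner H" .
    qed
    show "outer A \<le> outer (A \<inter> G) + outer (A - G)"
      using outer_Un_le[of "A \<inter> G" "A - G"] by (simp add: Int_Diff_Un)
  qed
  then show ?thesis unfolding lambda_system_eq by simp
qed

lemma measure_space_outer: "measure_space UNIV (sets borel) outer"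
proof -
  interpret P: sigma_algebra UNIV "UNIV :: 'a set set"
    using sigma_algebra_Pow[of "UNIV :: 'a set"] by simp
  have L: "measure_space UNIV (lambda_system UNIV UNIV outer) outer"
    by (rule P.caratheodory_lemma[OF outer_measure_space_outer])
  then interpret L: sigma_algebra UNIV "lambda_system UNIV UNIV outer"
    by (simp add: measure_space_def)
  have "sets borel = sigma_sets UNIV {G :: 'a set. open G}"
    by (simp add: borel_def)
  moreover have "sigma_sets UNIV {G. open G} \<subseteq> lambda_system UNIV UNIV outer"
    by (rule L.sigma_sets_subset) (use open_in_lambda_system in blast)
  ultimately have "sets borel \<subseteq> lambda_system UNIV UNIV outer"
    by simp
  moreover have "sigma_algebra UNIV (sets (borel :: 'a measure))"
    using sets.sigma_algebra_axioms[of "borel :: 'a measure"] by simp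
  ultimately show ?thesis using L measure_down by blast
qed

lemma space_radon_extension [simp]: "space radon_extension = UNIV"
  by (simp add: radon_extension_def space_measure_of_conv)

lemma sets_radon_extension [simp, measurable_cong]: "sets radon_extension = sets borel"
  unfolding radon_extension_def using sets.sigma_sets_eq[of borel] by simp

lemma emeasure_radon_extension: "B \<in> sets borel \<Longrightarrow> emeasure radon_extension B = outer B"
  unfolding radon_extension_def
  using measure_space_outer
  by (intro emeasure_measure_of_sigma) (auto simp: measure_space_def)

lemma emeasure_radon_extension_open: "open G \<Longrightarrow> emeasure radon_extension G = inner G"
  by (simp add: emeasure_radon_extension outer_open)

lemma content_le_radon_extension: "compact K \<Longrightarrow> m K \<le> emeasure radon_extension K"
  by (simp add: emeasure_radon_extension content_le_outer borel_compact)

lemma finite_measure_radon_extension: "finite_measure radon_extension"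
  using inner_finite[of UNIV]
  by (intro finite_measureI) (simp add: emeasure_radon_extension_open)

text \<open>
  For a Borel set \<open>B\<close>, outer approximation of \<open>- B\<close> by an open \<open>G\<close> yields the closed subset \<open>- G\<close>
  of \<open>B\<close>. It need not be compact, but almost all of the mass of the whole space sits on some
  compact \<open>L\<close>, and \<open>L - G\<close> misses at most \<open>G \<inter> B\<close> and \<open>- L\<close>.
\<close>

lemma radon_measure_radon_extension: "radon_measure radon_extension"
proof -
  interpret finite_measure radon_extension by (rule finite_measure_radon_extension)
  let ?\<mu> = "emeasure radon_extension"
  have "?\<mu> B \<le> (SUP K\<in>{K. K \<subseteq> B \<and> compact K}. ?\<mu> K)" if B: "B \<in> sets borel" for B
  proof (rule ennreal_le_epsilon)
    fix e :: real assume "e > 0"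
    then have e2: "e/2 > 0" by simp
    obtain G where G: "open G" "-B \<subseteq> G" "inner G \<le> outer (-B) + ennreal (e/2)"
      using outer_approx[OF e2] by blast
    obtain L where L: "compact L" "inner UNIV \<le> m L + ennreal (e/2)"
      using inner_approx[OF e2] by blast
    have Lb: "L \<in> sets borel" and Gb: "G \<in> sets borel"
      using L(1) G(1) by (auto intro: borel_compact)
    let ?K = "L - G"
    have K: "compact ?K" "?K \<subseteq> B" using L(1) G(1,2) by (auto intro: compact_diff)
    have "?\<mu> G = ?\<mu> (-B) + ?\<mu> (G \<inter> B)"
      using plus_emeasure[of "-B" radon_extension "G \<inter> B"] B Gb G(2)
      by (simp add: Un_Int_distrib Un_absorb1 Compl_partition2)
    then have "?\<mu> (-B) + ?\<mu> (G \<inter> B) \<le> ?\<mu> (-B) + ennreal (e/2)"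
      using G(1,3) B by (simp add: emeasure_radon_extension_open emeasure_radon_extension)
    then have GB: "?\<mu> (G \<inter> B) \<le> ennreal (e/2)"
      by (simp add: ennreal_add_left_cancel_le)
    have "?\<mu> UNIV = ?\<mu> L + ?\<mu> (-L)"
      using plus_emeasure[of L radon_extension "-L"] Lb by simp
    moreover have "?\<mu> UNIV \<le> ?\<mu> L + ennreal (e/2)"
      using L content_le_radon_extension[OF L(1)]
      by (auto simp: emeasure_radon_extension_open intro: order_trans add_right_mono)
    ultimately have LC: "?\<mu> (-L) \<le> ennreal (e/2)"
      by (simp add: ennreal_add_left_cancel_le)
    have "?\<mu> B \<le> ?\<mu> (?K \<union> ((G \<inter> B) \<union> -L))"
      using B Gb Lb by (intro emeasure_mono) auto
    also have "\<dots> \<le> ?\<mu> ?K + (?\<mu> (G \<inter> B) + ?\<mu> (-L))"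
      using B Gb Lb by (intro order_trans[OF emeasure_subadditive] add_left_mono emeasure_subadditive) auto
    also have "\<dots> \<le> ?\<mu> ?K + (ennreal (e/2) + ennreal (e/2))"
      using GB LC by (intro add_left_mono add_mono)
    also have "\<dots> = ?\<mu> ?K + ennreal e"
      using \<open>e > 0\<close> by (simp add: ennreal_plus[symmetric] del: ennreal_plus)
    also have "\<dots> \<le> (SUP K\<in>{K. K \<subseteq> B \<and> compact K}. ?\<mu> K) + ennreal e"
      using K by (intro add_right_mono SUP_upper) auto
    finally show "?\<mu> B \<le> (SUP K\<in>{K. K \<subseteq> B \<and> compact K}. ?\<mu> K) + ennreal e" .
  qed
  moreover have "(SUP K\<in>{K. K \<subseteq> B \<and> compact K}. ?\<mu> K) \<le> ?\<mu> B" if "B \<in> sets borel" for B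
    using that by (intro SUP_least emeasure_mono) auto
  ultimately show ?thesis
    unfolding radon_measure_def by (auto simp: less_top[symmetric] intro: antisym)
qed

text \<open>
  An inequality on compact sets is enough for invariance, since the extension has finite total
  mass and a map of the space into itself preserves that mass.
\<close>

lemma distr_radon_extension:
  assumes s: "continuous_on UNIV s" and le: "\<And>K. compact K \<Longrightarrow> m K \<le> m (s ` K)"
  shows "distr radon_extension radon_extension s = radon_extension"
proof -
  interpret finite_measure radon_extension by (rule finite_measure_radon_extension)
  let ?\<mu> = "emeasure radon_extension"
  have meas: "s \<in> borel_measurable borel" using s by (rule borel_measurable_continuous_onI)
  have pre: "s -` B \<in> sets borel" if "B \<in> sets borel" for B
    using measurable_sets[OF meas that] by simp
  have open_le: "inner (s -` G) \<le> inner G" if "open G" for G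
    unfolding inner_def[of "s -` G"]
  proof (rule SUP_least)
    fix K assume "K \<in> {K. K \<subseteq> s -` G \<and> compact K}"
    then have K: "compact K" "s ` K \<subseteq> G" by auto
    have "compact (s ` K)"
      by (rule compact_continuous_image[OF continuous_on_subset[OF s subset_UNIV] K(1)])
    then show "m K \<le> inner G"
      using order_trans[OF le[OF K(1)] le_inner] K(2) by simp
  qed
  have le_B: "?\<mu> (s -` B) \<le> ?\<mu> B" if B: "B \<in> sets borel" for B
  proof -
    have "outer (s -` B) \<le> inner G" if "open G" "B \<subseteq> G" for G
    proof -
      have "outer (s -` B) \<le> inner (s -` G)"
        using that s by (intro outer_le_inner) (auto intro: open_vimage)
      then show ?thesis using open_le[OF that(1)] by simp
    qed
    then have "outer (s -` B) \<le> outer B"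
      unfolding outer_def[of B] by (auto intro: INF_greatest)
    then show ?thesis using B pre by (simp add: emeasure_radon_extension)
  qed
  have ge_B: "?\<mu> B \<le> ?\<mu> (s -` B)" if B: "B \<in> sets borel" for B
  proof -
    have "?\<mu> B + ?\<mu> (s -` (-B)) \<le> ?\<mu> B + ?\<mu> (-B)"
      using B by (intro add_left_mono le_B) auto
    also have "\<dots> = ?\<mu> UNIV"
      using plus_emeasure[of B radon_extension "-B"] B by simp
    also have "\<dots> = ?\<mu> (s -` B) + ?\<mu> (s -` (-B))"
      using plus_emeasure[of "s -` B" radon_extension "s -` (-B)"] B pre[of B] pre[of "-B"]
      by (simp add: vimage_Compl)
    finally show ?thesis
      by (simp add: ennreal_add_left_cancel_le add.commute[of _ "?\<mu> (s -` (-B))"])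
  qed
  show ?thesis
    using le_B ge_B meas
    by (intro measure_eqI) (auto simp: emeasure_distr intro: antisym)
qed

end

section \<open>Visit frequencies along a Folner sequence\<close>

definition visit_frequency :: "('a \<Rightarrow> 'a) set \<Rightarrow> 'a \<Rightarrow> 'a set \<Rightarrow> real" where
  "visit_frequency F y A = (\<Sum>h\<in>F. indicator A (h y)) / real (card F)"

lemma visit_frequency_eq_card:
  "finite F \<Longrightarrow> visit_frequency F y A = real (card {h \<in> F. h y \<in> A}) / real (card F)"
  by (simp add: visit_frequency_def indicator_def sum.If_cases Int_def)

lemma visit_frequency_nonneg: "0 \<le> visit_frequency F y A"
  by (simp add: visit_frequency_def sum_nonneg)

lemma visit_frequency_le_1: "visit_frequency F y A \<le> 1"
proof -
  have "(\<Sum>h\<in>F. indicator A (h y)) \<le> (\<Sum>h\<in>F. 1 :: real)"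
    by (intro sum_mono) (simp add: indicator_def)
  then show ?thesis by (auto simp: visit_frequency_def divide_le_eq_1)
qed

lemma visit_frequency_Un:
  "A \<inter> B = {} \<Longrightarrow> visit_frequency F y (A \<union> B) = visit_frequency F y A + visit_frequency F y B"
  unfolding visit_frequency_def
  by (simp add: indicator_add[symmetric] sum.distrib add_divide_distrib)

text \<open>
  Composition with \<open>s\<close> need not be injective on \<open>F\<close>, so counting over \<open>F\<close> and over its
  image \<open>T\<close> differ. The loss is \<open>card F - card T\<close>, which is at most \<open>card (F - T)\<close>; passing from
  \<open>T\<close> back to \<open>F\<close> costs \<open>card (T - F)\<close>. Together these make up the symmetric difference.
\<close>

lemma visit_frequency_vimage_le:
  assumes "finite F"
  shows "visit_frequency F y (s -` A)
    \<le> visit_frequency F y A + real (card (sym_diff ((\<circ>) s ` F) F)) / real (card F)"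
proof -
  define T where "T = (\<circ>) s ` F"
  define N where "N = {h \<in> F. h y \<in> s -` A}"
  define TA where "TA = {g \<in> T. g y \<in> A}"
  define FA where "FA = {h \<in> F. h y \<in> A}"
  have fin: "finite T" "finite TA" "finite N" "finite FA"
    using assms by (auto simp: T_def TA_def N_def FA_def)
  \<comment> \<open>Counting complements turns the non-injective image into an inequality in the needed direction.\<close>
  have "T - TA = (\<circ>) s ` (F - N)"
    by (auto simp: T_def TA_def N_def) (metis comp_apply)
  then have "card (T - TA) \<le> card (F - N)"
    using assms by (simp add: card_image_le)
  moreover have "card (T - TA) + card TA = card T" "card (F - N) + card N = card F"
    using fin assms card_mono[of T TA] card_mono[of F N]
    by (auto simp: card_Diff_subset TA_def N_def)
  moreover have "card F \<le> card T + card (F - T)"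
    using card_mono[of "T \<union> (F - T)" F] card_Un_le[of T "F - T"] fin assms by auto
  moreover have "card TA \<le> card FA + card (T - F)"
    using card_mono[of "FA \<union> (T - F)" TA] card_Un_le[of FA "T - F"] fin
    by (force simp: TA_def FA_def)
  moreover have "card (sym_diff T F) = card (T - F) + card (F - T)"
    using fin assms by (intro card_Un_disjoint) auto
  ultimately have "card N \<le> card FA + card (sym_diff T F)" by linarith
  then have "real (card N) / card F \<le> (real (card FA) + real (card (sym_diff T F))) / card F"
    by (intro divide_right_mono) auto
  then show ?thesis
    using assms by (simp add: visit_frequency_eq_card N_def FA_def T_def add_divide_distrib)
qed

text \<open>
  Tychonoff's theorem gives a cluster point \<open>g\<close> in the product of the \<open>C b\<close>. A filter is used in
  place of a subsequence because the index type of the product is arbitrary, so that the product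
  need not be sequentially compact.
\<close>

lemma pointwise_convergent_subfilter:
  fixes f :: "'a \<Rightarrow> 'b \<Rightarrow> 'c::topological_space"
  assumes "F \<noteq> bot" and C: "\<And>b. compact (C b)" and f: "\<And>x b. f x b \<in> C b"
  obtains G g where "G \<noteq> bot" "G \<le> F" "\<And>b. ((\<lambda>x. f x b) \<longlongrightarrow> g b) G"
proof -
  have "compact (PiE UNIV C)"
    using C compactin_PiE[of "\<lambda>_. euclidean" UNIV C] by (simp add: euclidean_product_topology)
  moreover have "filtermap f F \<noteq> bot" using assms(1) by (simp add: filtermap_bot_iff)
  moreover have "eventually (\<lambda>h. h \<in> PiE UNIV C) (filtermap f F)"
    using f by (simp add: eventually_filtermap PiE_iff)
  ultimately obtain g where g: "inf (nhds g) (filtermap f F) \<noteq> bot"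
    unfolding compact_filter by blast
  define G where "G = inf F (filtercomap f (nhds g))"
  have "G \<noteq> bot"
  proof
    assume "G = bot"
    then have "eventually (\<lambda>_. False) G" by simp
    then obtain P Q where "eventually P F" "eventually Q (nhds g)" "\<And>x. P x \<Longrightarrow> Q (f x) \<Longrightarrow> False"
      unfolding G_def eventually_inf eventually_filtercomap by blast
    then have "eventually (\<lambda>h. \<not> Q h) (filtermap f F)" "eventually Q (nhds g)"
      by (auto simp: eventually_filtermap elim!: eventually_mono)
    then have "eventually (\<lambda>_. False) (inf (nhds g) (filtermap f F))"
      unfolding eventually_inf by blast
    then show False using g by (simp add: eventually_False)
  qed
  moreover have "G \<le> F" by (simp add: G_def)
  moreover have "((\<lambda>x. f x b) \<longlongrightarrow> g b) G" for b
  proof (rule topological_tendstoI)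
    fix U assume U: "open U" "g b \<in> U"
    have "(f \<longlongrightarrow> g) G"
      unfolding G_def by (rule filterlim_mono[OF filterlim_filtercomap]) auto
    moreover have "open ((\<lambda>h. h b) -` U :: ('b \<Rightarrow> 'c) set)"
      using U(1) continuous_on_product_coordinates by (rule open_vimage)
    ultimately show "eventually (\<lambda>x. f x b \<in> U) G"
      using U(2) topological_tendstoD[of f g G "(\<lambda>h. h b) -` U"] by simp
  qed
  ultimately show thesis using that by blast
qed

text \<open>
  The limit is taken inside the set of indices where the visits to \<open>A0\<close> are frequent, which
  keeps \<open>c \<le> m A0\<close>. Subinvariance holds for every choice of the base points \<open>y k\<close>, because the
  Folner error does not depend on them.
\<close>

lemma folner_limit_charge:
  fixes y :: "nat \<Rightarrow> 'a" and A0 :: "'a set"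
  assumes folner: "folner_sequence (\<circ>) S F"
    and freq: "\<exists>\<^sub>F k in sequentially. c \<le> visit_frequency (F k) (y k) A0"
  obtains m :: "'a set \<Rightarrow> real"
  where "\<And>A. 0 \<le> m A" "\<And>A. m A \<le> 1"
    "\<And>A B. A \<inter> B = {} \<Longrightarrow> m (A \<union> B) = m A + m B"
    "\<And>s A. s \<in> S \<Longrightarrow> m (s -` A) \<le> m A"
    "c \<le> m A0"
proof -
  define P where "P = inf sequentially (principal {k. c \<le> visit_frequency (F k) (y k) A0})"
  have "P \<noteq> bot"
    using freq unfolding P_def frequently_def
    by (auto simp: trivial_limit_def eventually_inf_principal)
  then obtain G m where G: "G \<noteq> bot" "G \<le> P"
    and m: "\<And>A. ((\<lambda>k. visit_frequency (F k) (y k) A) \<longlongrightarrow> m A) G"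
    using pointwise_convergent_subfilter[of P "\<lambda>_. {0..1}" "\<lambda>k. visit_frequency (F k) (y k)"]
      visit_frequency_nonneg visit_frequency_le_1 by (metis atLeastAtMost_iff compact_Icc)
  have Gseq: "G \<le> sequentially" using G(2) by (simp add: P_def)
  show thesis
  proof (rule that)
    show "0 \<le> m A" for A
      by (rule tendsto_lowerbound[OF m _ G(1)]) (simp add: visit_frequency_nonneg)
    show "m A \<le> 1" for A
      by (rule tendsto_upperbound[OF m _ G(1)]) (simp add: visit_frequency_le_1)
    show "m (A \<union> B) = m A + m B" if "A \<inter> B = {}" for A B
      using tendsto_unique[OF G(1) m[of "A \<union> B"]] tendsto_add[OF m[of A] m[of B]]
        visit_frequency_Un[OF that] by simp
    show "m (s -` A) \<le> m A" if s: "s \<in> S" for s A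
    proof (rule tendsto_le[OF G(1) _ m])
      let ?d = "\<lambda>k. real (card (sym_diff ((\<circ>) s ` F k) (F k))) / real (card (F k))"
      have "(?d \<longlongrightarrow> 0) G"
        using folner s by (intro tendsto_mono[OF Gseq]) (simp add: folner_sequence_def)
      from tendsto_add[OF m[of A] this]
      show "((\<lambda>k. visit_frequency (F k) (y k) A + ?d k) \<longlongrightarrow> m A) G" by simp
      have "eventually (\<lambda>k. finite (F k)) sequentially"
        using folner by (auto simp: folner_sequence_def eventually_sequentially)
      then have "eventually (\<lambda>k. finite (F k)) G" using Gseq by (rule filter_leD[rotated])
      then show "eventually (\<lambda>k. visit_frequency (F k) (y k) (s -` A)
          \<le> visit_frequency (F k) (y k) A + ?d k) G"
        by (rule eventually_mono) (rule visit_frequency_vimage_le)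
    qed
    have "eventually (\<lambda>k. c \<le> visit_frequency (F k) (y k) A0) P"
      by (auto simp: P_def eventually_inf_principal)
    then have "eventually (\<lambda>k. c \<le> visit_frequency (F k) (y k) A0) G"
      using G(2) by (rule filter_leD[rotated])
    then show "c \<le> m A0" using tendsto_lowerbound[OF m _ G(1)] by blast
  qed
qed

section \<open>The invariant probability measure\<close>

lemma frequently_visit_points:
  assumes "limsup (\<lambda>k. SUP s\<in>S. ereal (1 / real (card (F k)) *
           (\<Sum>h\<in>F k. indicator K0 ((h \<circ> s) x0)))) > 0"
  obtains c y where "0 < c" "\<exists>\<^sub>F k in sequentially. c \<le> visit_frequency (F k) (y k) K0"
proof -
  let ?u = "\<lambda>k s. visit_frequency (F k) (s x0) K0"
  have "0 < limsup (\<lambda>k. SUP s\<in>S. ereal (?u k s))"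
    using assms by (simp add: visit_frequency_def)
  then obtain c where c: "0 < ereal c" "ereal c < limsup (\<lambda>k. SUP s\<in>S. ereal (?u k s))"
    using ereal_dense2 by blast
  have "\<exists>\<^sub>F k in sequentially. ereal c < (SUP s\<in>S. ereal (?u k s))"
  proof (rule ccontr)
    assume "\<not> ?thesis"
    then have "eventually (\<lambda>k. (SUP s\<in>S. ereal (?u k s)) \<le> ereal c) sequentially"
      by (simp add: not_frequently not_less)
    then show False using Limsup_bounded c(2) by (metis not_less)
  qed
  then have freq: "\<exists>\<^sub>F k in sequentially. \<exists>s. c \<le> ?u k s"
    by (rule frequently_elim1) (auto simp: less_SUP_iff intro: less_imp_le)
  define y where "y k = (SOME s. c \<le> ?u k s) x0" for k
  have "\<exists>\<^sub>F k in sequentially. c \<le> visit_frequency (F k) (y k) K0"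
    using freq unfolding y_def by (rule frequently_elim1) (drule someI_ex, assumption)
  then show thesis using that c(1) by simp
qed

text \<open>
  The mass \<open>t\<close> carried by compact sets can be smaller than \<open>m UNIV\<close>, so the content is divided by
  \<open>t\<close> rather than by \<open>m UNIV\<close>; \<open>t\<close> is positive because it is at least \<open>m K0\<close>.
\<close>

lemma invariant_radon_probability:
  fixes m :: "'a::t2_space set \<Rightarrow> real"
  assumes nonneg: "\<And>A. 0 \<le> m A" and bound: "\<And>A. m A \<le> 1"
    and add: "\<And>A B. A \<inter> B = {} \<Longrightarrow> m (A \<union> B) = m A + m B"
    and cont: "\<And>s. s \<in> S \<Longrightarrow> continuous_on UNIV s"
    and sub: "\<And>s A. s \<in> S \<Longrightarrow> m (s -` A) \<le> m A"
    and K0: "compact K0" "0 < m K0"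
  shows "\<exists>\<mu>::'a measure. prob_space \<mu> \<and> radon_measure \<mu> \<and> invariant_measure S \<mu> \<and>
           measure \<mu> K0 > 0"
proof -
  have m_mono: "m A \<le> m B" if "A \<subseteq> B" for A B
    using add[of A "B - A"] nonneg[of "B - A"] that by (simp add: Un_absorb1)
  have subadd: "m (A \<union> B) \<le> m A + m B" for A B
    using add[of A "B - A"] m_mono[of "B - A" B] by simp
  define t where "t = (SUP K\<in>{K. compact K}. ennreal (m K))"
  define n where "n K = ennreal (m K) * inverse t" for K
  have "ennreal (m K0) \<le> t" unfolding t_def using K0(1) by (auto intro: SUP_upper)
  then have t0: "t \<noteq> 0" using K0(2) by (auto simp: ennreal_eq_0_iff)
  have "t \<le> 1" unfolding t_def using bound by (auto intro!: SUP_least)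
  then have t1: "t \<noteq> top" by (auto simp: top_unique)
  have "(SUP K\<in>{K. compact K}. n K) = t * inverse t"
    unfolding n_def by (subst (2) t_def) (rule SUP_mult_right_ennreal[symmetric])
  also have "\<dots> = 1" using t0 t1 by (simp add: divide_ennreal_def[symmetric] less_top[symmetric])
  finally have total: "(SUP K\<in>{K. compact K}. n K) = 1" .
  interpret compact_content n
  proof
    show "n K \<le> n L" if "K \<subseteq> L" for K L
      unfolding n_def using m_mono[OF that] by (intro mult_right_mono ennreal_leI) auto
    show "n (K \<union> L) \<le> n K + n L" for K L
      unfolding n_def distrib_right[symmetric] using subadd nonneg
      by (intro mult_right_mono) (auto simp: ennreal_plus[symmetric] ennreal_leI simp del: ennreal_plus)
    show "n (K \<union> L) = n K + n L" if "K \<inter> L = {}" for K L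
      unfolding n_def distrib_right[symmetric] using add[OF that] nonneg by simp
    show "(SUP K\<in>{K. compact K}. n K) < \<infinity>" using total by simp
  qed
  have "prob_space radon_extension"
    by (intro prob_spaceI) (simp add: emeasure_radon_extension_open inner_def total)
  then interpret prob_space radon_extension .
  have "distr radon_extension radon_extension s = radon_extension" if s: "s \<in> S" for s
  proof (rule distr_radon_extension)
    show "continuous_on UNIV s" using s by (rule cont)
    fix K :: "'a set"
    have "m K \<le> m (s -` s ` K)" by (rule m_mono) auto
    also have "\<dots> \<le> m (s ` K)" using s by (rule sub)
    finally show "n K \<le> n (s ` K)"
      unfolding n_def by (intro mult_right_mono ennreal_leI) auto
  qed
  then have "invariant_measure S radon_extension" by (simp add: invariant_measure_def)
  moreover have "0 < n K0"
    using K0(2) t1 by (simp add: n_def ennreal_zero_less_mult_iff less_top ennreal_inverse_positive)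
  then have "0 < emeasure radon_extension K0"
    using content_le_radon_extension[OF K0(1)] by (rule less_le_trans)
  then have "0 < measure radon_extension K0" by (simp add: emeasure_eq_measure)
  ultimately show ?thesis
    using radon_measure_radon_extension \<open>prob_space radon_extension\<close> by blast
qed

theorem theorem4p4:
  fixes S :: "('a::t2_space \<Rightarrow> 'a) set"
    and F :: "nat \<Rightarrow> ('a \<Rightarrow> 'a) set"
    and x0 :: 'a
    and K0 :: "'a set"
  assumes "continuous_map_semigroup S"
    and "countable S"
    and "folner_sequence (\<circ>) S F"
    and "compact K0"
    and "limsup (\<lambda>k. SUP s\<in>S. ereal (1 / real (card (F k)) *
           (\<Sum>h\<in>F k. indicator K0 ((h \<circ> s) x0)))) > 0"
  shows "\<exists>\<mu>::'a measure. prob_space \<mu> \<and> radon_measure \<mu> \<and> invariant_measure S \<mu> \<and>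
           measure \<mu> K0 > 0"
proof -
  obtain c y where "0 < c" "\<exists>\<^sub>F k in sequentially. c \<le> visit_frequency (F k) (y k) K0"
    using frequently_visit_points[OF assms(5)] by blast
  with assms(3) obtain m :: "'a set \<Rightarrow> real"
    where "\<And>A. 0 \<le> m A" "\<And>A. m A \<le> 1" "\<And>A B. A \<inter> B = {} \<Longrightarrow> m (A \<union> B) = m A + m B"
      "\<And>s A. s \<in> S \<Longrightarrow> m (s -` A) \<le> m A" "c \<le> m K0"
    using folner_limit_charge[of S F c y K0] by blast
  moreover have "\<And>s. s \<in> S \<Longrightarrow> continuous_on UNIV s"
    using assms(1) by (simp add: continuous_map_semigroup_def)
  ultimately show ?thesis
    using invariant_radon_probability[of m S K0] assms(4) \<open>0 < c\<close> by force
qed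

end
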